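(* Let $X,Z$ be real normed spaces, $K\subset X$ a closed convex pointed cone with $\operatorname{int}K\ne\emptyset$, $F:Z\rightrightarrows X$ a set-valued map, $M\subset Z$ a closed set, and $\overline z\in M$. Suppose that $\overline z$ is a sharp weak minimum for $F$ on $M$ with constant $\mu>0$ and element $e\in K\setminus\{0\}$, i.e. for all $z\in M$, $$F(\overline z)\not\subset F(z)-\mu\|z-\overline z\|e+\operatorname{int}K.$$ Then for all $T\in\widehat\partial^{+}F(\overline z)$ and all $u\in T_B(M,\overline z)$, $$T(u)\notin\mu\|u\|e-\operatorname{int}K.$$
   Context: Sums of sets are Minkowski sums. $B(Z,X)$ is the space of bounded linear operators from $Z$ to $X$. A cone $K$ is pointed if $K\cap(-K)=\{0\}$. The excess is $e(A,B)=\sup_{x\in A}d(x,B)=\inf\{\alpha>0\mid A\subset B+\alpha D_X\}$, where $D_X$ is the closed unit ball of $X$ and $\inf\emptyset=+\infty$ (the two-argument excess $e(\cdot,\cdot)$ is not to be confused with the vector $e$). With $\operatorname{Epi}F(z)=F(z)+K$, the upper subdifferential of $F$ at $\overline z$ is $$\widehat\partial^{+}F(\overline z)=\Bigl\{T\in B(Z,X)\ \Big|\ \lim_{z\to\overline z}\frac{e\bigl(\operatorname{Epi}F(\overline z)+T(z-\overline z),\operatorname{Epi}F(z)\bigr)}{\|z-\overline z\|}=0\Bigr\}.$$ The Bouligand tangent cone to $M$ at $\overline z\in M$ is $$T_B(M,\overline z)=\{u\in Z\mid\exists (t_n)\downarrow0,\ \exists (u_n)\to u,\ \forall n\in\mathbb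 N,\ \overline z+t_nu_n\in M\},$$ where $(t_n)\downarrow 0$ means a sequence of positive reals converging to $0$. *)

theory Defs
  imports "HOL-Analysis.Analysis" "HOL-Library.Set_Algebras"
begin

text \<open>
  Sums of sets are Minkowski sums, and translation by a vector \<open>v\<close> is written \<open>{v} + A\<close>.
  On sets, the unary and binary minus signs denote complement and set difference; the reflected set
  \<open>{- x | x \<in> A}\<close> is therefore written \<open>uminus ` A\<close>.
\<close>

definition pointed_cone :: "'x::real_normed_vector set \<Rightarrow> bool" where
  "pointed_cone K \<longleftrightarrow> cone K \<and> K \<inter> uminus ` K = {0}"

text \<open>
  The excess takes values in \<open>[0, \<infinity>]\<close>: the infimum of the empty set in \<^typ>\<open>ereal\<close> is \<open>\<infinity>\<close>,
  so the excess of a nonempty set over the empty set is \<open>\<infinity>\<close>, and the excess of the empty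
  set over any set is \<open>0\<close>.
\<close>

definition excess :: "'x::real_normed_vector set \<Rightarrow> 'x set \<Rightarrow> ereal" where
  "excess A B = Inf {ereal \<alpha> | \<alpha>. \<alpha> > 0 \<and> A \<subseteq> B + (*\<^sub>R) \<alpha> ` cball 0 1}"

definition Epi :: "'x::real_normed_vector set \<Rightarrow> ('z \<Rightarrow> 'x set) \<Rightarrow> 'z \<Rightarrow> 'x set" where
  "Epi K F z = F z + K"

definition upper_subdifferential ::
  "'x::real_normed_vector set \<Rightarrow> ('z::real_normed_vector \<Rightarrow> 'x set) \<Rightarrow> 'z \<Rightarrow> ('z \<Rightarrow>\<^sub>L 'x) set" where
  "upper_subdifferential K F z0 =
     {T. ((\<lambda>z. excess (Epi K F z0 + {blinfun_apply T (z - z0)}) (Epi K F z) / ereal (norm (z - z0)))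
            \<longlongrightarrow> 0) (at z0)}"

definition bouligand_cone :: "'z::real_normed_vector set \<Rightarrow> 'z \<Rightarrow> 'z set" where
  "bouligand_cone M z0 =
     {u. \<exists>(t :: nat \<Rightarrow> real) (v :: nat \<Rightarrow> 'z).
           (\<forall>n. t n > 0) \<and> t \<longlonglongrightarrow> 0 \<and> v \<longlonglongrightarrow> u \<and> (\<forall>n. z0 + t n *\<^sub>R v n \<in> M)}"

definition sharp_weak_minimum ::
  "'x::real_normed_vector set \<Rightarrow> ('z::real_normed_vector \<Rightarrow> 'x set) \<Rightarrow> 'z set \<Rightarrow> real \<Rightarrow> 'x \<Rightarrow> 'z \<Rightarrow> bool"
where
  "sharp_weak_minimum K F M \<mu> e z0 \<longleftrightarrow>
     (\<forall>z\<in>M. \<not> F z0 \<subseteq> F z + {- ((\<mu> * norm (z - z0)) *\<^sub>R e)} + interior K)"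

end

theory Submission
  imports Defs
begin

text \<open>
  Suppose that \<open>T u = \<mu> \<parallel>u\<parallel> e - k\<close> with \<open>k\<close> in the interior of \<open>K\<close>, and let \<open>z\<^sub>n = z0 + t\<^sub>n v\<^sub>n\<close> be points of \<open>M\<close>
  realising the tangent direction \<open>u\<close>. Pointedness excludes \<open>u = 0\<close>. For large \<open>n\<close>, the point
  \<open>x + t\<^sub>n T v\<^sub>n\<close> with \<open>x \<in> F z0\<close> lies in \<open>F z\<^sub>n + K\<close> up to an error that is small compared with \<open>t\<^sub>n\<close>;
  since \<open>\<mu> \<parallel>v\<^sub>n\<parallel> e - T v\<^sub>n\<close> is close to \<open>k\<close>, the interior absorbs the error and
  \<open>x \<in> F z\<^sub>n - \<mu> \<parallel>z\<^sub>n - z0\<parallel> e + int K\<close>. This inclusion of all of \<open>F z0\<close> contradicts sharp weak minimality.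
\<close>

text \<open>The ball of radius \<open>t * r\<close> around \<open>x + t *\<^sub>R a\<close> is the
  translate by \<open>x\<close> of \<open>t\<close> times \<open>ball a r\<close>, and a convex cone
  is closed under positive scaling and addition. The tolerance for the perturbation
  \<open>t *\<^sub>R w\<close> thus shrinks only linearly in \<open>t\<close>.\<close>

lemma convex_cone_add_scaled_ball_interior:
  fixes K :: "'a::real_normed_vector set"
  assumes "convex K" "cone K" "ball a r \<subseteq> K" "x \<in> K" "t > 0" "norm w < r"
  shows "x + t *\<^sub>R (a + w) \<in> interior K"
proof (rule interiorI)
  show "open (ball (x + t *\<^sub>R a) (t * r))" by simp
  show "x + t *\<^sub>R (a + w) \<in> ball (x + t *\<^sub>R a) (t * r)"
    using assms(5,6) by (simp add: dist_norm scaleR_add_right)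
  show "ball (x + t *\<^sub>R a) (t * r) \<subseteq> K"
  proof
    fix y assume y: "y \<in> ball (x + t *\<^sub>R a) (t * r)"
    define b where "b = (1 / t) *\<^sub>R (y - x)"
    have yb: "y = x + t *\<^sub>R b" using \<open>t > 0\<close> by (simp add: b_def)
    have "t * norm (a - b) < t * r"
      using y \<open>t > 0\<close>
      by (simp add: yb dist_norm flip: scaleR_diff_right)
    then have "b \<in> K" using assms(3,5) by (auto simp: dist_norm)
    then have "t *\<^sub>R b \<in> K" using \<open>cone K\<close> \<open>t > 0\<close> by (simp add: cone_def)
    then show "y \<in> K"
      unfolding yb using assms(1,2,4) convex_cone by blast
  qed
qed

text \<open>A ball around 0 inside \<open>K\<close> would contain a small positive multiple of
  \<open>- e\<close>; rescaling puts \<open>- e\<close> next to \<open>e\<close> in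
  \<open>K\<close>, against pointedness.\<close>

lemma zero_notin_interior_pointed_cone:
  fixes K :: "'a::real_normed_vector set"
  assumes "pointed_cone K" "e \<in> K" "e \<noteq> 0"
  shows "0 \<notin> interior K"
proof
  assume "0 \<in> interior K"
  then obtain r where r: "r > 0" "ball 0 r \<subseteq> K" by (auto simp: mem_interior)
  have cone: "cone K" and pointed: "K \<inter> uminus ` K = {0}"
    using assms(1) by (auto simp: pointed_cone_def)
  define c where "c = r / (2 * norm e)"
  have c: "c > 0" using r(1) assms(3) by (simp add: c_def)
  have "c *\<^sub>R (- e) \<in> ball 0 r" using r(1) assms(3) by (simp add: c_def)
  then have "c *\<^sub>R (- e) \<in> K" using r(2) by blast
  then have "(1 / c) *\<^sub>R c *\<^sub>R (- e) \<in> K" using cone c by (meson cone_def divide_nonneg_pos zero_le_one)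
  then have "- e \<in> K" using c by simp
  then have "e \<in> K \<inter> uminus ` K" using assms(2) by (auto intro: image_eqI[of _ _ "- e"])
  then show False using pointed assms(3) by simp
qed

text \<open>The strict bound yields an admissible radius \<alpha> below \<open>c\<close>, so the
  infimum need not be attained.\<close>

lemma excess_less_decompose:
  assumes "excess A B < ereal c" "x \<in> A"
  obtains b w where "b \<in> B" "norm w < c" "x = b + w"
proof -
  obtain \<alpha> where \<alpha>: "\<alpha> > 0" "\<alpha> < c" "A \<subseteq> B + (*\<^sub>R) \<alpha> ` cball 0 1"
    using assms(1) unfolding excess_def Inf_less_iff by auto
  then obtain b d where "b \<in> B" "norm d \<le> 1" "x = b + \<alpha> *\<^sub>R d"
    using assms(2) by (auto simp: set_plus_def subset_iff)
  moreover have "norm (\<alpha> *\<^sub>R d) < c"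
    using le_less_trans[OF mult_left_le[OF \<open>norm d \<le> 1\<close> less_imp_le[OF \<alpha>(1)]] \<alpha>(2)] \<alpha>(1)
    by simp
  ultimately show ?thesis using that by blast
qed

lemma upper_subdifferential_tangent_descent_not_sharp:
  fixes K :: "'x::real_normed_vector set"
    and F :: "'z::real_normed_vector \<Rightarrow> 'x set"
  assumes "convex K" "pointed_cone K"
    and T: "T \<in> upper_subdifferential K F z0"
    and u: "u \<in> bouligand_cone M z0" "u \<noteq> 0"
    and Tu: "(\<mu> * norm u) *\<^sub>R e - blinfun_apply T u \<in> interior K"
  shows "\<not> sharp_weak_minimum K F M \<mu> e z0"
proof -
  define k where "k = (\<mu> * norm u) *\<^sub>R e - blinfun_apply T u"
  have "cone K" "0 \<in> K" using assms(2) by (auto simp: pointed_cone_def)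
  obtain r where r: "r > 0" "ball k r \<subseteq> K"
    using Tu by (auto simp: k_def mem_interior)
  obtain t v where t: "\<And>n. t n > 0" "t \<longlonglongrightarrow> 0" and v: "v \<longlonglongrightarrow> u"
    and M: "\<And>n::nat. z0 + t n *\<^sub>R v n \<in> M"
    using u(1) by (auto simp: bouligand_cone_def)
  define z where "z n = z0 + t n *\<^sub>R v n" for n
  \<comment> \<open>Chosen so that \<open>norm (v n) < norm u + 1\<close> gives
    \<open>\<delta> * norm (v n) < r / 2\<close>: half of the radius \<open>r\<close> is reserved
    for the excess error, the other half for the convergence to \<open>k\<close>.\<close>
  define \<delta> where "\<delta> = r / (2 * (norm u + 1))"
  have \<delta>: "\<delta> > 0" using r(1) by (simp add: \<delta>_def add_nonneg_pos)
  \<comment> \<open>Since \<open>u\<close> is nonzero, \<open>z n\<close> eventually differs from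
    \<open>z0\<close>, as the limit over the punctured neighbourhood requires.\<close>
  have v0: "\<forall>\<^sub>F n in sequentially. v n \<noteq> 0"
    using v u(2) by (rule tendsto_imp_eventually_ne)
  have "(\<lambda>n. z0 + t n *\<^sub>R v n) \<longlonglongrightarrow> z0 + 0 *\<^sub>R u"
    by (intro tendsto_intros t v)
  then have "z \<longlonglongrightarrow> z0" by (simp add: z_def [abs_def])
  moreover have "\<forall>\<^sub>F n in sequentially. z n \<noteq> z0"
    using v0 by eventually_elim (use t(1) in \<open>simp add: z_def less_imp_neq[symmetric]\<close>)
  ultimately have "filterlim z (at z0) sequentially"
    by (simp add: filterlim_at)
  with T have "(\<lambda>n. excess (Epi K F z0 + {blinfun_apply T (z n - z0)}) (Epi K F (z n))
      / ereal (norm (z n - z0))) \<longlonglongrightarrow> 0"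
    unfolding upper_subdifferential_def using filterlim_compose by fastforce
  then have excess_small: "\<forall>\<^sub>F n in sequentially.
      excess (Epi K F z0 + {blinfun_apply T (z n - z0)}) (Epi K F (z n))
        / ereal (norm (z n - z0)) < ereal \<delta>"
    using \<delta> by (intro order_tendstoD(2)) auto
  have v_bound: "\<forall>\<^sub>F n in sequentially. norm (v n) < norm u + 1"
    using tendsto_norm[OF v] by (rule order_tendstoD) simp
  have "(\<lambda>n. (\<mu> * norm (v n)) *\<^sub>R e - blinfun_apply T (v n)) \<longlonglongrightarrow> k"
    unfolding k_def by (intro tendsto_intros v)
  then have near_k: "\<forall>\<^sub>F n in sequentially.
      dist ((\<mu> * norm (v n)) *\<^sub>R e - blinfun_apply T (v n)) k < r / 2"
    using r(1) by (intro tendstoD) auto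
  \<comment> \<open>One index suffices: a single point of \<open>M\<close> with the inclusion
    refutes sharpness.\<close>
  obtain n where n: "v n \<noteq> 0" "norm (v n) < norm u + 1"
    "dist ((\<mu> * norm (v n)) *\<^sub>R e - blinfun_apply T (v n)) k < r / 2"
    "excess (Epi K F z0 + {blinfun_apply T (z n - z0)}) (Epi K F (z n))
        / ereal (norm (z n - z0)) < ereal \<delta>"
    using eventually_happens[OF eventually_conj[OF v0 eventually_conj[OF v_bound
      eventually_conj[OF near_k excess_small]]]] by auto
  have zn: "z n - z0 = t n *\<^sub>R v n" by (simp add: z_def)
  have norm_zn: "norm (z n - z0) = t n * norm (v n)" using t(1)[of n] by (simp add: zn)
  have "0 < norm (z n - z0)" using n(1) t(1) by (simp add: norm_zn)
  then have excess_n: "excess (Epi K F z0 + {blinfun_apply T (z n - z0)}) (Epi K F (z n))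
      < ereal (\<delta> * norm (z n - z0))"
    using n(4) by (subst (asm) ereal_divide_less_iff) (simp_all add: mult.commute)
  have "\<delta> * norm (v n) < \<delta> * (norm u + 1)" using n(2) \<delta> by (rule mult_strict_left_mono)
  also have "\<dots> = r / 2"
    using norm_ge_zero[of u] by (simp add: \<delta>_def add_nonneg_eq_0_iff field_simps)
  finally have \<delta>_vn: "\<delta> * norm (v n) < r / 2" .
  have "F z0 \<subseteq> F (z n) + {- ((\<mu> * norm (z n - z0)) *\<^sub>R e)} + interior K"
  proof
    fix x assume "x \<in> F z0"
    then have "x + 0 + blinfun_apply T (z n - z0) \<in> Epi K F z0 + {blinfun_apply T (z n - z0)}"
      unfolding Epi_def using \<open>0 \<in> K\<close> by (intro set_plus_intro) auto
    with excess_n obtain b w where bw: "b \<in> Epi K F (z n)" "norm w < \<delta> * norm (z n - z0)"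
      "x + 0 + blinfun_apply T (z n - z0) = b + w"
      by (rule excess_less_decompose)
    obtain y h where yh: "y \<in> F (z n)" "h \<in> K" "b = y + h"
      using bw(1) by (auto simp: Epi_def set_plus_def)
    \<comment> \<open>Both errors, rescaled by \<open>1 / t n\<close>, so that
      \<open>t n *\<^sub>R (k + q)\<close> equals \<open>w\<close> plus \<open>t n\<close> times the
      vector close to \<open>k\<close>.\<close>
    define q where "q = (1 / t n) *\<^sub>R w
      + ((\<mu> * norm (v n)) *\<^sub>R e - blinfun_apply T (v n) - k)"
    have "norm w < t n * (\<delta> * norm (v n))" using bw(2) by (simp add: norm_zn mult_ac)
    also have "\<dots> < t n * (r / 2)" using \<delta>_vn t(1) by (rule mult_strict_left_mono)
    finally have "norm ((1 / t n) *\<^sub>R w) < r / 2" using t(1)[of n] by (simp add: field_simps)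
    then have "norm q < r"
      using n(3) norm_triangle_ineq[of "(1 / t n) *\<^sub>R w"
          "(\<mu> * norm (v n)) *\<^sub>R e - blinfun_apply T (v n) - k"]
      unfolding q_def dist_norm by linarith
    then have "h + t n *\<^sub>R (k + q) \<in> interior K"
      using convex_cone_add_scaled_ball_interior[OF \<open>convex K\<close> \<open>cone K\<close> r(2) yh(2) t(1)]
      by blast
    \<comment> \<open>Solve the decomposition for \<open>x\<close>, then subtract and add the
      multiple of \<open>e\<close>; the added copy is absorbed into
      \<open>t n *\<^sub>R (k + q)\<close>.\<close>
    moreover have "x = y + - ((\<mu> * norm (z n - z0)) *\<^sub>R e) + (h + t n *\<^sub>R (k + q))"
    proof -
      have "t n *\<^sub>R (k + q) = w + (t n * (\<mu> * norm (v n))) *\<^sub>R e - t n *\<^sub>R blinfun_apply T (v n)"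
        using t(1)[of n] by (simp add: q_def scaleR_add_right scaleR_diff_right)
      moreover have "x = y + h + w - t n *\<^sub>R blinfun_apply T (v n)"
        using bw(3) by (simp add: zn blinfun.scaleR_right yh(3) eq_diff_eq)
      moreover have "(\<mu> * norm (z n - z0)) *\<^sub>R e = (t n * (\<mu> * norm (v n))) *\<^sub>R e"
        by (simp add: norm_zn mult_ac)
      ultimately show ?thesis by (simp only:) simp
    qed
    ultimately show "x \<in> F (z n) + {- ((\<mu> * norm (z n - z0)) *\<^sub>R e)} + interior K"
      using yh(1) by (auto intro!: set_plus_intro simp del: add_uminus_conv_diff)
  qed
  then show ?thesis
    using M[of n] unfolding sharp_weak_minimum_def z_def by blast
qed

theorem proposition3p16:
  fixes K :: "'x::real_normed_vector set"
    and F :: "'z::real_normed_vector \<Rightarrow> 'x set"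
    and M :: "'z set"
    and z0 :: 'z
    and \<mu> :: real
    and e :: 'x
  assumes "closed K" and "convex K" and "pointed_cone K" and "interior K \<noteq> {}"
    and "closed M" and "z0 \<in> M"
    and "\<mu> > 0" and "e \<in> K - {0}"
    and "sharp_weak_minimum K F M \<mu> e z0"
  shows "\<forall>T \<in> upper_subdifferential K F z0. \<forall>u \<in> bouligand_cone M z0.
           blinfun_apply T u \<notin> {(\<mu> * norm u) *\<^sub>R e} + uminus ` interior K"
proof (intro ballI notI)
  fix T u
  assume T: "T \<in> upper_subdifferential K F z0" and u: "u \<in> bouligand_cone M z0"
    and "blinfun_apply T u \<in> {(\<mu> * norm u) *\<^sub>R e} + uminus ` interior K"
  then have Tu: "(\<mu> * norm u) *\<^sub>R e - blinfun_apply T u \<in> interior K"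
    by (auto simp: set_plus_def)
  \<comment> \<open>For \<open>u = 0\<close> the vector in \<open>Tu\<close> is 0.\<close>
  then have "u \<noteq> 0"
    using zero_notin_interior_pointed_cone[OF assms(3), of e] assms(8) by auto
  then show False
    using upper_subdifferential_tangent_descent_not_sharp[OF assms(2,3) T u _ Tu] assms(9)
    by blast
qed

end
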